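(* Let $H$ be a real Hilbert space and let $F=f+g$, where $f:H\to\mathbb{R}$ is $\mu$-strongly convex ($\mu>0$) and $L$-smooth ($L>0$), and $g:H\to\mathbb{R}\cup\{\infty\}$ is convex, proper and lower-semicontinuous. Assume that $\mathcal{S}=\operatorname{argmin}_{x\in H}F(x)$ is nonempty, let $F^*=\min_{x\in H}F(x)$ and let $x^*\in\mathcal{S}$. Let $s\in\left(0,\frac1L\right]$, $\theta=\sqrt{\mu s}$, and $\lambda_{k+1}=\frac{1-\theta}{1+\theta}$ for all $k\ge 0$. Let $\gamma_0=s$ and $\gamma_{k+1}=(1+\lambda_{k+1})s$ for $k\ge 0$. Let $z_0\in H$, $x_0=\operatorname{prox}_{\gamma_0 g}(z_0)$, $y_0=x_0-s\nabla f(x_0)$, and let $(x_k)_{k\ge0}$, $(y_k)_{k\ge 0}$, $(z_k)_{k\ge 0}$ be generated, for $k\ge 0$, by $$\begin{aligned} y_{k+1} &= x_k-s\nabla f(x_k),\\ z_{k+1} &= y_{k+1}+\lambda_{k+1}(y_{k+1}-y_k)+\frac{\lambda_{k+1}s}{\gamma_k}(z_k-x_k),\\ x_{k+1} &= \operatorname{prox}_{\gamma_{k+1}g}(z_{k+1}).\end{aligned}$$ Then, for every $k\ge 0$, $$F(x_k)-F^*\le (1-\theta)^k\left[F(x_0)-F^*+\frac{\theta}{1+\theta}\eta_0+\frac{\theta}{2s}\|x_0-x^*\|^2\right],$$ where $\eta_0:=\left\langle\frac{z_0-x_0}{\gamma_0},x_0-x^*\right\rangle-\left(g(x_0)-g(x^*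 )\right)$.
   Context: $L$-smooth means that $f$ is (Fréchet) differentiable with $L$-Lipschitz continuous gradient $\nabla f$. $\mu$-strongly convex means that $f-\frac{\mu}{2}\|\cdot\|^2$ is convex. For $\gamma>0$, $\operatorname{prox}_{\gamma g}(z)=\operatorname{argmin}_{x\in H}\left\{\gamma g(x)+\frac12\|x-z\|^2\right\}$ for $z\in H$. The convention $0^0=1$ is used. *)

theory Defs
  imports "HOL-Analysis.Analysis"
begin

definition gradient :: "('a::real_inner \<Rightarrow> real) \<Rightarrow> 'a \<Rightarrow> 'a"
  where "gradient f x = (THE D. GDERIV f x :> D)"

definition smooth :: "real \<Rightarrow> ('a::real_inner \<Rightarrow> real) \<Rightarrow> bool"
  where "smooth L f \<longleftrightarrow> (\<forall>x. f differentiable (at x)) \<and> L-lipschitz_on UNIV (gradient f)"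

definition strongly_convex :: "real \<Rightarrow> ('a::real_inner \<Rightarrow> real) \<Rightarrow> bool"
  where "strongly_convex \<mu> f \<longleftrightarrow> convex_on UNIV (\<lambda>x. f x - \<mu> / 2 * (norm x)\<^sup>2)"

(* In ereal, 0 * \<infinity> = 0, so the cases u = 0 and v = 0 are trivially true. *)
definition ereal_convex :: "('a::real_vector \<Rightarrow> ereal) \<Rightarrow> bool"
  where "ereal_convex g \<longleftrightarrow>
    (\<forall>x y. \<forall>u\<ge>0. \<forall>v\<ge>0. u + v = 1 \<longrightarrow>
      g (u *\<^sub>R x + v *\<^sub>R y) \<le> ereal u * g x + ereal v * g y)"

definition proper :: "('a \<Rightarrow> ereal) \<Rightarrow> bool"
  where "proper g \<longleftrightarrow> (\<forall>x. g x \<noteq> -\<infinity>) \<and> (\<exists>x. g x \<noteq> \<infinity>)"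

definition lower_semicontinuous :: "('a::topological_space \<Rightarrow> ereal) \<Rightarrow> bool"
  where "lower_semicontinuous g \<longleftrightarrow> (\<forall>x. g x \<le> Liminf (at x) g)"

(* For \<gamma> > 0 and g convex, proper and lower semicontinuous on a Hilbert space the
   minimizer exists and is unique, so the choice made by arg_min is immaterial. *)
definition prox :: "real \<Rightarrow> ('a::real_inner \<Rightarrow> ereal) \<Rightarrow> 'a \<Rightarrow> 'a"
  where "prox \<gamma> g z =
    arg_min (\<lambda>x. ereal \<gamma> * g x + ereal (1 / 2 * (norm (x - z))\<^sup>2)) (\<lambda>_. True)"

end

theory Submission
  imports Defs
begin

text \<open>
  Write $d_k = \nabla f(x_k)$ and $u_k = (z_k - x_k)/\gamma_k$. Optimality of the proximal point
  makes $u_k$ a subgradient of $g$ at $x_k$, and the recursion for $z_k$ becomes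
  \[ (1+\theta) x_{k+1} + 2 s u_{k+1} = 2 y_{k+1} - (1-\theta) y_k + (1-\theta) s u_k, \]
  where $y_k = x_{k-1} - s d_{k-1}$ holds for all $k$ with the convention $x_{-1} = x_0$. This
  convention is exactly truncated subtraction on indices, and so the start needs no separate
  treatment.

  The rate comes from a Lyapunov function. Let $G_k = x_k - y_k + s u_k$, $e_k = x_k - x^*$ and
  \[ \Psi_k = f(x_{k-1}) + g(x_k) + \langle u_k, x_{k-1} - x_k\rangle
       - \tfrac{s}{2} \|d_{k-1} + u_k\|^2, \qquad
     \Phi_k = \Psi_k - F^* + \tfrac{1}{2s} \|G_k + \theta e_k\|^2. \]
  The vector $x_k + G_k/\theta$ plays the role of the mirror sequence in Nesterov's method: it is
  averaged with $x_k$ with weights $1-\theta$ and $\theta$, and then moved along $d_k + u_{k+1}$.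
  In $\Psi_k$ the value of $g$ at $x_{k-1}$ is replaced by its linear lower bound from $x_k$. With
  $g(x_{k-1})$ itself the weights used below for the subgradient inequalities would stop being
  nonnegative when $\theta > 1/2$.

  Cocoercivity of the gradient reads
  $F(x_k) \le \Psi_k + \langle d_k + u_k, G_k\rangle - \frac{s}{2} \|d_k + u_k\|^2$.
  Three facts follow.
  \<^item> Adding $\theta$ times the strong convexity inequality of $F$ from $x_k$ towards $x^*$ and completing the square
    gives $(1+\theta)(F(x_k) - F^*) \le \Phi_k$.
  \<^item> $\Phi_{k+1} \le (1-\theta) \Phi_k$, by a nonnegative combination of five inequalities whose
    remainder is minus a weighted sum of two squares (\<open>lyapunov_identity\<close>, \<open>lyapunov_step\<close>).
  \<^item> $\Phi_0 = F(x_0) - F^* + \theta\langle d_0+u_0, e_0\rangle + \frac{\theta^2}{2s}\|e_0\|^2$,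
    which by the descent lemma is at most $1+\theta$ times the bracket in the claim.

  Together these give the rate (\<open>accelerated_rate\<close>). The multiplier $1-\theta$ must be nonnegative.
  This holds because $\mu \le L$ as soon as the space has two points; in the trivial space both
  sides vanish.

  On the analytic side, the proximal points and the Riesz representation that yields gradients
  both come from one minimization theorem, \<open>prox_is_arg_min\<close>, and the subgradient and convexity
  inequalities both come from Fermat's rule, \<open>subgradient_at_minimizer\<close>.
\<close>

section \<open>Subgradients from minimization\<close>

lemma DERIV_along_line:
  fixes h :: "'a::real_inner \<Rightarrow> real"
  assumes "GDERIV h (x + t *\<^sub>R v) :> D"
  shows "((\<lambda>t. h (x + t *\<^sub>R v)) has_real_derivative inner v D) (at t)"
proof -
  have "((\<lambda>t. x + t *\<^sub>R v) has_derivative (\<lambda>t. t *\<^sub>R v)) (at t)"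
    by (auto intro!: derivative_eq_intros)
  from has_derivative_compose[OF this assms[unfolded gderiv_def]]
  show ?thesis
    by (simp add: has_field_derivative_def mult_commute_abs)
qed

text \<open>Fermat's rule for a sum of a differentiable and a convex function. If the inequality failed
  at \<open>w\<close>, then $h$ plus the chord of $g$ would have a negative derivative at \<open>x\<close> in the direction
  of \<open>w\<close>, while convexity keeps $g$ below its chord.\<close>
lemma subgradient_at_minimizer:
  fixes h :: "'a::real_inner \<Rightarrow> real" and g :: "'a \<Rightarrow> ereal"
  assumes h: "GDERIV h x :> D" and g: "ereal_convex g" and fin: "g x = ereal c"
    and min: "\<And>w. ereal (h x) + g x \<le> ereal (h w) + g w"
  shows "g x + ereal (inner (- D) (w - x)) \<le> g w"
proof (cases "g w")
  case MInf
  with min[of w] fin show ?thesis by simp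
next
  case (real b)
  show ?thesis
  proof (rule ccontr)
    assume "\<not> ?thesis"
    hence neg: "inner (w - x) D + (b - c) < 0"
      using real fin by (simp add: inner_commute)
    let ?p = "\<lambda>t. h (x + t *\<^sub>R (w - x)) + t * (b - c)"
    have "((\<lambda>t. h (x + t *\<^sub>R (w - x))) has_real_derivative inner (w - x) D) (at 0)"
      using h by (intro DERIV_along_line) simp
    hence "(?p has_real_derivative inner (w - x) D + (b - c)) (at 0)"
      by (auto intro!: derivative_eq_intros)
    from DERIV_neg_dec_right[OF this neg] obtain d
      where d: "d > 0" "\<And>t. 0 < t \<Longrightarrow> t < d \<Longrightarrow> ?p t < h x"
      by auto
    define t where "t = min (d / 2) 1"
    have t: "0 < t" "t < d" "t \<le> 1" using d(1) by (auto simp: t_def)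
    have eq: "x + t *\<^sub>R (w - x) = (1 - t) *\<^sub>R x + t *\<^sub>R w"
      by (simp add: algebra_simps)
    have "g (x + t *\<^sub>R (w - x)) \<le> ereal (1 - t) * g x + ereal t * g w"
      unfolding eq using g t by (auto simp: ereal_convex_def)
    also have "\<dots> = ereal ((1 - t) * c + t * b)" using fin real by simp
    finally have "ereal (h (x + t *\<^sub>R (w - x))) + g (x + t *\<^sub>R (w - x))
        \<le> ereal (h (x + t *\<^sub>R (w - x))) + ereal ((1 - t) * c + t * b)"
      by (rule add_left_mono)
    with min[of "x + t *\<^sub>R (w - x)"] fin
    have "ereal (h x + c) \<le> ereal (h (x + t *\<^sub>R (w - x)) + ((1 - t) * c + t * b))"
      by (metis order_trans plus_ereal.simps(1))
    hence "h x + c \<le> h (x + t *\<^sub>R (w - x)) + ((1 - t) * c + t * b)" by simp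
    with d(2)[OF t(1,2)] show False by (simp add: algebra_simps)
  qed
qed simp

section \<open>Existence of proximal points\<close>

lemma lower_semicontinuous_sequentially:
  fixes g :: "'a::topological_space \<Rightarrow> ereal"
  assumes "lower_semicontinuous g" "X \<longlonglongrightarrow> w" "ereal c < g w"
  shows "\<forall>\<^sub>F n in sequentially. ereal c < g (X n)"
proof -
  have "ereal c < Liminf (at w) g"
    using assms by (auto simp: lower_semicontinuous_def intro: less_le_trans)
  hence "\<forall>\<^sub>F y in at w. ereal c < g y" by (rule less_LiminfD)
  hence "\<forall>\<^sub>F y in nhds w. ereal c < g y"
    using assms(3) by (auto simp: eventually_at_filter elim!: eventually_mono)
  thus ?thesis using assms(2) by (auto simp: filterlim_iff)
qed

text \<open>The parallelogram law, in the form that measures the strict convexity of the squared distance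
  to \<open>z\<close>.\<close>
lemma norm_midpoint:
  fixes p q z :: "'a::real_inner"
  shows "(norm ((1/2) *\<^sub>R p + (1/2) *\<^sub>R q - z))\<^sup>2
    = (norm (p - z))\<^sup>2 / 2 + (norm (q - z))\<^sup>2 / 2 - (norm (p - q))\<^sup>2 / 4"
  by (simp add: power2_norm_eq_inner inner_simps inner_commute field_simps)

text \<open>A minimizing sequence is Cauchy because the quadratic term makes the value at a midpoint
  smaller than the average of the two values, by an eighth of the squared distance; lower
  semicontinuity turns its limit into a minimizer. The growth hypothesis bounds the objective from
  below, since the quadratic term dominates any multiple of the norm.\<close>
lemma prox_is_arg_min:
  fixes g :: "'a::{real_inner, complete_space} \<Rightarrow> ereal"
  assumes \<gamma>: "\<gamma> > 0" and conv: "ereal_convex g" and propr: "proper g"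
    and lsc: "lower_semicontinuous g"
    and growth: "\<And>x. ereal (a - b * norm x) \<le> g x"
  shows "is_arg_min (\<lambda>x. ereal \<gamma> * g x + ereal (1 / 2 * (norm (x - z))\<^sup>2)) (\<lambda>_. True)
    (prox \<gamma> g z)"
proof -
  define S where "S = {x. g x \<noteq> \<infinity>}"
  define r where "r x = real_of_ereal (g x)" for x
  define \<phi> where "\<phi> x = \<gamma> * r x + 1 / 2 * (norm (x - z))\<^sup>2" for x
  have gr: "g x = ereal (r x)" if "x \<in> S" for x
    using that propr unfolding S_def r_def proper_def by (cases "g x") auto
  have S_ne: "S \<noteq> {}" using propr by (auto simp: proper_def S_def)
  have bdd: "bdd_below (\<phi> ` S)"
  proof (rule bdd_belowI2)
    fix x assume "x \<in> S"
    have "a - b * norm x \<le> r x" using growth[of x] gr[OF \<open>x \<in> S\<close>] by simp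
    moreover have "b * norm x \<le> \<bar>b\<bar> * (norm (x - z) + norm z)"
    proof -
      have "norm x \<le> norm (x - z) + norm z"
        by (metis diff_add_cancel norm_triangle_ineq)
      thus ?thesis by (intro mult_mono) auto
    qed
    ultimately have "\<gamma> * (a - \<bar>b\<bar> * (norm (x - z) + norm z)) \<le> \<gamma> * r x"
      using \<gamma> by (intro mult_left_mono) auto
    moreover have "0 \<le> (norm (x - z) - \<gamma> * \<bar>b\<bar>)\<^sup>2 / 2" by simp
    ultimately show "\<gamma> * (a - \<bar>b\<bar> * norm z) - (\<gamma> * \<bar>b\<bar>)\<^sup>2 / 2 \<le> \<phi> x"
      unfolding \<phi>_def by (simp add: power2_eq_square algebra_simps)
  qed
  define I where "I = Inf (\<phi> ` S)"
  have I_le: "I \<le> \<phi> x" if "x \<in> S" for x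
    unfolding I_def using that bdd by (auto intro: cInf_lower)
  have "\<exists>x\<in>S. \<phi> x < I + 1 / real (Suc n)" for n
    using cInf_lessD[of "\<phi> ` S" "I + 1 / real (Suc n)"] S_ne by (auto simp: I_def)
  then obtain X where X: "\<And>n. X n \<in> S" "\<And>n. \<phi> (X n) < I + 1 / real (Suc n)"
    by metis
  have close: "(norm (X m - X n))\<^sup>2 \<le> 4 / real (Suc m) + 4 / real (Suc n)" for m n
  proof -
    let ?w = "(1/2) *\<^sub>R X m + (1/2) *\<^sub>R X n"
    have "g ?w \<le> ereal (1/2) * g (X m) + ereal (1/2) * g (X n)"
      using conv unfolding ereal_convex_def by (auto simp del: times_ereal.simps)
    hence le: "g ?w \<le> ereal (r (X m) / 2 + r (X n) / 2)"
      using gr[OF X(1)[of m]] gr[OF X(1)[of n]] by simp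
    hence w: "?w \<in> S" by (auto simp: S_def)
    have "r ?w \<le> r (X m) / 2 + r (X n) / 2" using le gr[OF w] by simp
    hence "\<gamma> * r ?w \<le> \<gamma> * (r (X m) / 2 + r (X n) / 2)"
      using \<gamma> by (intro mult_left_mono) auto
    hence "\<phi> ?w \<le> \<phi> (X m) / 2 + \<phi> (X n) / 2 - (norm (X m - X n))\<^sup>2 / 8"
      unfolding \<phi>_def norm_midpoint by (simp add: field_simps)
    with I_le[OF w] X(2)[of m] X(2)[of n] show ?thesis by simp
  qed
  have "Cauchy X"
  proof (rule metric_CauchyI)
    fix e :: real assume "e > 0"
    then obtain N :: nat where N: "8 / e\<^sup>2 < real N" using reals_Archimedean2 by blast
    have N0: "0 < real N" using N \<open>e > 0\<close> by (smt (verit) divide_pos_pos zero_less_power)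
    have "dist (X m) (X n) < e" if "m \<ge> N" "n \<ge> N" for m n
    proof -
      have "4 / real (Suc m) \<le> 4 / real N" "4 / real (Suc n) \<le> 4 / real N"
        using that N0 by (auto intro!: divide_left_mono)
      hence "(norm (X m - X n))\<^sup>2 \<le> 8 / real N" using close[of m n] by linarith
      also have "\<dots> < e\<^sup>2" using N N0 \<open>e > 0\<close> by (simp add: field_simps)
      finally show ?thesis using \<open>e > 0\<close> by (simp add: dist_norm power_less_imp_less_base)
    qed
    thus "\<exists>M. \<forall>m\<ge>M. \<forall>n\<ge>M. dist (X m) (X n) < e" by blast
  qed
  then obtain w where w: "X \<longlonglongrightarrow> w"
    using convergent_eq_Cauchy[of X] by (auto simp: convergent_def)
  have lim: "(\<lambda>n. (I + 1 / real (Suc n) - 1 / 2 * (norm (X n - z))\<^sup>2) / \<gamma>)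
      \<longlonglongrightarrow> (I + 0 - 1 / 2 * (norm (w - z))\<^sup>2) / \<gamma>"
    using \<gamma> by (intro tendsto_intros w LIMSEQ_Suc[OF lim_1_over_n]) auto
  \<comment> \<open>Pass to the limit below any level \<open>c\<close> under \<open>g w\<close>; this also shows that \<open>g w\<close> is finite.\<close>
  have "g w \<le> ereal ((I - 1 / 2 * (norm (w - z))\<^sup>2) / \<gamma>)"
  proof (rule dense_le)
    fix c assume c: "c < g w"
    show "c \<le> ereal ((I - 1 / 2 * (norm (w - z))\<^sup>2) / \<gamma>)"
    proof (cases c)
      case (real c')
      have "\<forall>\<^sub>F n in sequentially. ereal c' < g (X n)"
        using lower_semicontinuous_sequentially[OF lsc w] c real by simp
      hence "\<forall>\<^sub>F n in sequentially. c' \<le> (I + 1 / real (Suc n) - 1 / 2 * (norm (X n - z))\<^sup>2) / \<gamma>"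
      proof (rule eventually_mono)
        fix n assume "ereal c' < g (X n)"
        hence "\<gamma> * c' \<le> \<gamma> * r (X n)" using gr[OF X(1)[of n]] \<gamma> by simp
        also have "\<dots> \<le> I + 1 / real (Suc n) - 1 / 2 * (norm (X n - z))\<^sup>2"
          using X(2)[of n] unfolding \<phi>_def by linarith
        finally show "c' \<le> (I + 1 / real (Suc n) - 1 / 2 * (norm (X n - z))\<^sup>2) / \<gamma>"
          using \<gamma> by (simp only: pos_le_divide_eq mult.commute[of c'])
      qed
      from tendsto_lowerbound[OF lim this] real show ?thesis by simp
    qed (use c in auto)
  qed
  moreover from this have wS: "w \<in> S" by (auto simp: S_def)
  ultimately have "r w \<le> (I - 1 / 2 * (norm (w - z))\<^sup>2) / \<gamma>"
    using gr[OF wS] by simp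
  hence w_le: "\<phi> w \<le> I" using \<gamma> by (simp add: \<phi>_def field_simps)
  have "is_arg_min (\<lambda>x. ereal \<gamma> * g x + ereal (1 / 2 * (norm (x - z))\<^sup>2)) (\<lambda>_. True) w"
    unfolding is_arg_min_linorder
  proof (intro conjI allI impI TrueI)
    fix v
    show "ereal \<gamma> * g w + ereal (1 / 2 * (norm (w - z))\<^sup>2)
      \<le> ereal \<gamma> * g v + ereal (1 / 2 * (norm (v - z))\<^sup>2)"
    proof (cases "v \<in> S")
      case True
      thus ?thesis using gr[OF wS] gr[OF True] w_le I_le[OF True] by (simp add: \<phi>_def)
    next
      case False
      thus ?thesis using \<gamma> by (simp add: S_def)
    qed
  qed
  thus ?thesis unfolding prox_def arg_min_def by (rule someI)
qed

lemma prox_subgradient: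
  fixes g :: "'a::{real_inner, complete_space} \<Rightarrow> ereal"
  assumes \<gamma>: "\<gamma> > 0" and conv: "ereal_convex g" and propr: "proper g"
    and lsc: "lower_semicontinuous g"
    and growth: "\<And>x. ereal (a - b * norm x) \<le> g x"
  shows "g (prox \<gamma> g z) \<noteq> \<infinity>"
    and "g (prox \<gamma> g z) + ereal (inner ((z - prox \<gamma> g z) /\<^sub>R \<gamma>) (w - prox \<gamma> g z)) \<le> g w"
proof -
  define p where "p = prox \<gamma> g z"
  have min: "ereal \<gamma> * g p + ereal (1 / 2 * (norm (p - z))\<^sup>2)
      \<le> ereal \<gamma> * g v + ereal (1 / 2 * (norm (v - z))\<^sup>2)" for v
    using prox_is_arg_min[OF assms] by (auto simp: is_arg_min_linorder p_def)
  obtain v c where v: "g v = ereal c"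
    using propr unfolding proper_def by (metis ereal_cases)
  show fin: "g (prox \<gamma> g z) \<noteq> \<infinity>"
    using min[of v] v \<gamma> by (auto simp: p_def)
  then obtain c where c: "g p = ereal c"
    using propr unfolding proper_def p_def by (metis ereal_cases)
  let ?h = "\<lambda>v. 1 / 2 * (norm (v - z))\<^sup>2 / \<gamma>"
  have "GDERIV ?h p :> (p - z) /\<^sub>R \<gamma>"
    unfolding gderiv_def power2_norm_eq_inner
    using \<gamma> by (auto intro!: derivative_eq_intros simp: inner_commute inner_diff field_simps)
  moreover have "ereal (?h p) + g p \<le> ereal (?h v) + g v" for v
  proof (cases "g v")
    case (real d)
    have "\<gamma> * c + 1 / 2 * (norm (p - z))\<^sup>2 \<le> \<gamma> * d + 1 / 2 * (norm (v - z))\<^sup>2"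
      using min[of v] c real by simp
    hence "(\<gamma> * c + 1 / 2 * (norm (p - z))\<^sup>2) / \<gamma> \<le> (\<gamma> * d + 1 / 2 * (norm (v - z))\<^sup>2) / \<gamma>"
      using \<gamma> by (intro divide_right_mono) auto
    hence "?h p + c \<le> ?h v + d" using \<gamma> by (simp add: add_divide_distrib)
    thus ?thesis using c real by simp
  next
    case MInf
    thus ?thesis using propr by (simp add: proper_def)
  qed simp
  ultimately have "g p + ereal (inner (- ((p - z) /\<^sub>R \<gamma>)) (w - p)) \<le> g w"
    by (rule subgradient_at_minimizer[OF _ conv c])
  thus "g (prox \<gamma> g z) + ereal (inner ((z - prox \<gamma> g z) /\<^sub>R \<gamma>) (w - prox \<gamma> g z)) \<le> g w"
    unfolding p_def[symmetric] by (simp flip: scaleR_minus_right)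
qed

section \<open>Gradients and smooth convex functions\<close>

text \<open>The proximal point of \<open>- \<phi>\<close> at the origin minimizes $\frac12 \|x\|^2 - \phi(x)$, and the
  optimality condition there says that it represents \<open>\<phi>\<close>.\<close>
lemma Riesz_representation:
  fixes \<phi> :: "'a::{real_inner, complete_space} \<Rightarrow> real"
  assumes "bounded_linear \<phi>"
  shows "\<exists>D. \<forall>v. \<phi> v = inner v D"
proof -
  interpret bounded_linear \<phi> by fact
  let ?g = "\<lambda>x. ereal (- \<phi> x)"
  obtain K where K: "\<And>x. norm (\<phi> x) \<le> norm x * K" using bounded by blast
  have growth: "ereal (0 - K * norm x) \<le> ?g x" for x
    using K[of x] by (simp add: mult.commute abs_le_iff)
  have conv: "ereal_convex ?g"
    by (auto simp: ereal_convex_def add scale)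
  have lsc: "lower_semicontinuous ?g"
    unfolding lower_semicontinuous_def
  proof
    fix x
    have "(?g \<longlongrightarrow> ?g x) (at x)"
      by (intro tendsto_intros tendsto[OF tendsto_ident_at])
    thus "?g x \<le> Liminf (at x) ?g"
      by (cases "at x = bot") (simp, metis lim_imp_Liminf order_refl)
  qed
  define D where "D = - prox 1 ?g 0"
  have le: "\<phi> v \<le> - inner D v" for v
    using prox_subgradient(2)[OF zero_less_one conv _ lsc growth, of 0 "v + prox 1 ?g 0"]
    by (simp add: proper_def D_def add)
  have "\<phi> v = inner v (- D)" for v
    using le[of v] le[of "- v"] by (simp add: neg inner_commute)
  thus ?thesis by blast
qed

lemma GDERIV_gradient:
  fixes f :: "'a::{real_inner, complete_space} \<Rightarrow> real"
  assumes "f differentiable (at x)"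
  shows "GDERIV f x :> gradient f x"
proof -
  from assms obtain f' where f': "(f has_derivative f') (at x)"
    by (auto simp: differentiable_def)
  obtain D where D: "\<And>v. f' v = inner v D"
    using Riesz_representation[OF has_derivative_bounded_linear[OF f']] by blast
  have "GDERIV f x :> D"
    unfolding gderiv_def by (rule has_derivative_eq_rhs[OF f']) (simp add: fun_eq_iff D)
  moreover have "E = D" if "GDERIV f x :> E" for E
  proof -
    have "inner (E - D) E = inner (E - D) D"
      using has_derivative_unique that \<open>GDERIV f x :> D\<close> unfolding gderiv_def by metis
    hence "inner (E - D) (E - D) = 0" by (simp add: inner_diff_right)
    thus ?thesis by simp
  qed
  ultimately show ?thesis unfolding gradient_def by (rule theI)
qed

text \<open>The point \<open>x\<close> trivially minimizes $(-h) + h = 0$, so Fermat's rule applies with \<open>- h\<close> as the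
  differentiable part and \<open>h\<close> as the convex part.\<close>
lemma convex_gradient_inequality:
  fixes h :: "'a::real_inner \<Rightarrow> real"
  assumes "convex_on UNIV h" "GDERIV h x :> D"
  shows "h x + inner D (w - x) \<le> h w"
proof -
  have "ereal_convex (\<lambda>x. ereal (h x))"
    using assms(1) by (auto simp: ereal_convex_def convex_on_def)
  from subgradient_at_minimizer[OF GDERIV_minus[OF assms(2)] this refl, of w]
  show ?thesis by simp
qed

lemma strongly_convex_gradient_inequality:
  fixes f :: "'a::real_inner \<Rightarrow> real"
  assumes "strongly_convex \<mu> f" "GDERIV f x :> D"
  shows "f x + inner D (w - x) + \<mu> / 2 * (norm (w - x))\<^sup>2 \<le> f w"
proof -
  have "GDERIV (\<lambda>x. \<mu> / 2 * (norm x)\<^sup>2) x :> \<mu> *\<^sub>R x"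
    unfolding gderiv_def power2_norm_eq_inner
    by (auto intro!: derivative_eq_intros simp: inner_commute)
  from convex_gradient_inequality[OF _ GDERIV_diff[OF assms(2) this], of w] assms(1)
  show ?thesis
    unfolding strongly_convex_def
    by (simp add: power2_norm_eq_inner inner_simps inner_commute algebra_simps)
qed

text \<open>Along the segment, $f$ minus the claimed quadratic upper bound has a nonpositive derivative
  by the Lipschitz condition.\<close>
lemma descent_lemma:
  fixes f :: "'a::real_inner \<Rightarrow> real"
  assumes f': "\<And>x. GDERIV f x :> f' x" and lip: "M-lipschitz_on UNIV f'"
  shows "f w \<le> f x + inner (f' x) (w - x) + M / 2 * (norm (w - x))\<^sup>2"
proof -
  define v where "v = w - x"
  let ?p = "\<lambda>t. f (x + t *\<^sub>R v) - t * inner (f' x) v - M / 2 * t\<^sup>2 * (norm v)\<^sup>2"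
  have "?p 1 \<le> ?p 0"
  proof (rule DERIV_nonpos_imp_nonincreasing[of 0 1 ?p])
    fix t :: real assume t: "0 \<le> t" "t \<le> 1"
    let ?D = "inner v (f' (x + t *\<^sub>R v)) - inner (f' x) v - M * t * (norm v)\<^sup>2"
    have "(?p has_real_derivative ?D) (at t)"
      by (auto intro!: derivative_eq_intros DERIV_along_line f')
    moreover have "?D \<le> 0"
    proof -
      have "inner v (f' (x + t *\<^sub>R v) - f' x) \<le> norm v * norm (f' (x + t *\<^sub>R v) - f' x)"
        by (rule norm_cauchy_schwarz)
      also have "\<dots> \<le> norm v * (M * norm (t *\<^sub>R v))"
        using lipschitz_on_normD[OF lip, of "x + t *\<^sub>R v" x] by (intro mult_left_mono) auto
      also have "\<dots> = M * t * (norm v)\<^sup>2" using t by (simp add: power2_eq_square)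
      finally show ?thesis by (simp add: inner_diff_right inner_commute)
    qed
    ultimately show "\<exists>D. (?p has_real_derivative D) (at t) \<and> D \<le> 0" by blast
  qed simp
  thus ?thesis by (simp add: v_def)
qed

text \<open>Compare two bounds on the value at \<open>v\<close>, which is the minimizer of the quadratic upper bound
  of $f - \langle f'(x), \cdot\rangle$ around \<open>w\<close>: the tangent at \<open>x\<close> from below and the descent
  lemma from above.\<close>
lemma cocoercivity:
  fixes f :: "'a::real_inner \<Rightarrow> real"
  assumes f': "\<And>x. GDERIV f x :> f' x"
    and conv: "\<And>x w. f x + inner (f' x) (w - x) \<le> f w"
    and s: "s > 0" and lip: "(1 / s)-lipschitz_on UNIV f'"
  shows "f x + inner (f' x) (w - x) + s / 2 * (norm (f' w - f' x))\<^sup>2 \<le> f w"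
proof -
  define v where "v = w - s *\<^sub>R (f' w - f' x)"
  have "f x + inner (f' x) (v - x) \<le> f v"
    by (rule conv)
  also have "\<dots> \<le> f w + inner (f' w) (v - w) + (1 / s) / 2 * (norm (v - w))\<^sup>2"
    by (rule descent_lemma[OF f' lip])
  also have "(1 / s) / 2 * (norm (v - w))\<^sup>2 = s / 2 * (norm (f' w - f' x))\<^sup>2"
    using s by (simp add: v_def power_mult_distrib power2_eq_square)
  finally have "f x + inner (f' x) (v - x) - inner (f' w) (v - w)
      \<le> f w + s / 2 * (norm (f' w - f' x))\<^sup>2" by simp
  moreover have "inner (f' x) (v - x) - inner (f' w) (v - w)
      = inner (f' x) (w - x) + s * (norm (f' w - f' x))\<^sup>2"
    by (simp add: v_def power2_norm_eq_inner inner_simps inner_commute algebra_simps)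
  ultimately show ?thesis by simp
qed

text \<open>At \<open>p\<close>, the quadratic lower bound of $f$ around \<open>q\<close> stays below the upper one only if
  \<open>\<mu> \<le> L\<close>.\<close>
lemma strong_convexity_le_smoothness:
  fixes f :: "'a::real_inner \<Rightarrow> real" and p q :: 'a
  assumes f': "\<And>x. GDERIV f x :> f' x" and sc: "strongly_convex \<mu> f"
    and lip: "L-lipschitz_on UNIV f'" and ne: "p \<noteq> q"
  shows "\<mu> \<le> L"
proof -
  have "\<mu> / 2 * (norm (p - q))\<^sup>2 \<le> L / 2 * (norm (p - q))\<^sup>2"
    using strongly_convex_gradient_inequality[OF sc f', of q p] descent_lemma[OF f' lip, of p q]
    by linarith
  thus ?thesis using ne by simp
qed

section \<open>The Lyapunov function\<close>

text \<open>The algebraic core of the decay of the Lyapunov function. In the application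
  $q = d_k + u_{k+1}$, $\delta = u_{k+1} - u_k$ (hence $q - \delta = d_k + u_k$), $D = x_{k+1} - x_k$
  and $(1+\theta) D + 2 s q = (1-\theta) G$. The vectors \<open>A\<close>, \<open>B\<close>, \<open>C\<close>, \<open>E\<close> are rescaled copies of
  these data: they solve the linear relation without dividing by $1+\theta$, so that the claim is a
  polynomial identity in independent vectors.\<close>
lemma lyapunov_identity:
  fixes A B C E :: "'a::real_inner" and s \<theta> :: real
  assumes s: "s \<noteq> 0"
  defines "G \<equiv> (s * (1 + \<theta>)) *\<^sub>R A" and "q \<equiv> (1 + \<theta>) *\<^sub>R B" and "\<delta> \<equiv> (1 + \<theta>) *\<^sub>R C"
    and "e \<equiv> s *\<^sub>R E" and "D \<equiv> s *\<^sub>R ((1 - \<theta>) *\<^sub>R A - 2 *\<^sub>R B)"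
  shows "(norm ((1 - \<theta>) *\<^sub>R G + \<theta> *\<^sub>R e - s *\<^sub>R q))\<^sup>2 / (2 * s) - s / 2 * (norm q)\<^sup>2
      - (1 - \<theta>) * ((norm (G + \<theta> *\<^sub>R e))\<^sup>2 / (2 * s))
      + (1 - \<theta>) * (inner (q - \<delta>) G - s / 2 * (norm (q - \<delta>))\<^sup>2)
      + \<theta> * (inner q e - \<theta>\<^sup>2 / (2 * s) * (norm e)\<^sup>2)
      + (1 - \<theta>) * inner \<delta> D
    = - (1 - \<theta>) * s / 2 * ((norm (q - \<delta> + 2 *\<^sub>R C))\<^sup>2 + \<theta> * (norm ((1 + \<theta>) *\<^sub>R A + 2 *\<^sub>R C))\<^sup>2)"
  using s
  unfolding assms(2-) power2_norm_eq_inner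
  by (simp add: inner_simps inner_commute power2_eq_square field_simps)

text \<open>The five hypotheses on \<open>\<phi>\<close>, \<open>\<psi>\<close>, \<open>\<psi>'\<close> are, in order: cocoercivity between the iterates
  $k-1$ and $k$, strong convexity from $x_k$ towards $x^*$, and the subgradient inequalities of $g$
  from $x_{k+1}$ towards $x^*$, from $x_{k+1}$ towards $x_k$ and from $x_k$ towards $x_{k+1}$. They
  are added with the weights $1-\theta$, $\theta$, $\theta$, $2-2\theta$, $1-\theta$. The second and
  third weights are forced by the terms containing $x^*$; of the last two only the difference
  is forced by the function values, and this choice turns the remaining quadratic form into the
  squares of \<open>lyapunov_identity\<close>.\<close>
lemma lyapunov_step:
  fixes G e d u u' D :: "'a::real_inner"
  assumes \<theta>: "0 < \<theta>" "\<theta> \<le> 1" and s: "s > 0"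
    and rel: "(1 + \<theta>) *\<^sub>R D + (2 * s) *\<^sub>R (d + u') = (1 - \<theta>) *\<^sub>R G"
    and i: "\<phi> + \<psi> \<le> \<Psi> + inner (d + u) G - s / 2 * (norm (d + u))\<^sup>2"
    and ii: "\<phi> \<le> \<phi>\<^sub>m + inner d e - \<theta>\<^sup>2 / (2 * s) * (norm e)\<^sup>2"
    and iii: "\<psi>' \<le> \<psi>\<^sub>m + inner u' (e + D)"
    and iv: "\<psi>' \<le> \<psi> + inner u' D"
    and v: "\<psi> \<le> \<psi>' - inner u D"
  shows "\<phi> + \<psi>' - inner u' D - s / 2 * (norm (d + u'))\<^sup>2 - (\<phi>\<^sub>m + \<psi>\<^sub>m)
      + (norm ((1 - \<theta>) *\<^sub>R G + \<theta> *\<^sub>R e - s *\<^sub>R (d + u')))\<^sup>2 / (2 * s)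
    \<le> (1 - \<theta>) * (\<Psi> - (\<phi>\<^sub>m + \<psi>\<^sub>m) + (norm (G + \<theta> *\<^sub>R e))\<^sup>2 / (2 * s))"
proof -
  define A where "A = G /\<^sub>R (s * (1 + \<theta>))"
  define B where "B = (d + u') /\<^sub>R (1 + \<theta>)"
  define C where "C = (u' - u) /\<^sub>R (1 + \<theta>)"
  define E where "E = e /\<^sub>R s"
  have pos: "1 + \<theta> \<noteq> 0" "s \<noteq> 0" "s * (1 + \<theta>) \<noteq> 0" using \<theta> s by auto
  have G: "(s * (1 + \<theta>)) *\<^sub>R A = G" and q: "(1 + \<theta>) *\<^sub>R B = d + u'"
    and \<delta>: "(1 + \<theta>) *\<^sub>R C = u' - u" and e: "s *\<^sub>R E = e"
    unfolding A_def B_def C_def E_def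
    using pos by (simp_all only: scaleR_scaleR right_inverse scaleR_one not_False_eq_True)
  have "(1 + \<theta>) *\<^sub>R D = (1 + \<theta>) *\<^sub>R s *\<^sub>R ((1 - \<theta>) *\<^sub>R A - 2 *\<^sub>R B)"
  proof -
    have "(1 + \<theta>) *\<^sub>R D = (1 - \<theta>) *\<^sub>R G - (2 * s) *\<^sub>R (d + u')"
      using rel by (simp add: algebra_simps)
    also have "\<dots> = (1 + \<theta>) *\<^sub>R s *\<^sub>R ((1 - \<theta>) *\<^sub>R A - 2 *\<^sub>R B)"
      unfolding G[symmetric] q[symmetric] by (simp add: algebra_simps)
    finally show ?thesis .
  qed
  hence D: "s *\<^sub>R ((1 - \<theta>) *\<^sub>R A - 2 *\<^sub>R B) = D" using pos(1) by (metis scaleR_left_imp_eq)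
  have p: "d + u' - (u' - u) = d + u" by simp
  \<comment> \<open>Atomic names for the squared norms keep the final rearrangement linear in them.\<close>
  define N\<^sub>1 where "N\<^sub>1 = (norm ((1 - \<theta>) *\<^sub>R G + \<theta> *\<^sub>R e - s *\<^sub>R (d + u')))\<^sup>2 / (2 * s)"
  define N\<^sub>2 where "N\<^sub>2 = (norm (G + \<theta> *\<^sub>R e))\<^sup>2 / (2 * s)"
  define N\<^sub>3 where "N\<^sub>3 = s / 2 * (norm (d + u'))\<^sup>2"
  define N\<^sub>4 where "N\<^sub>4 = s / 2 * (norm (d + u))\<^sup>2"
  define N\<^sub>5 where "N\<^sub>5 = \<theta>\<^sup>2 / (2 * s) * (norm e)\<^sup>2"
  note N_defs = N\<^sub>1_def N\<^sub>2_def N\<^sub>3_def N\<^sub>4_def N\<^sub>5_def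
  have "N\<^sub>1 - N\<^sub>3 - (1 - \<theta>) * N\<^sub>2 + (1 - \<theta>) * (inner (d + u) G - N\<^sub>4)
      + \<theta> * (inner (d + u') e - N\<^sub>5) + (1 - \<theta>) * inner (u' - u) D
    = - (1 - \<theta>) * s / 2 * ((norm (d + u + 2 *\<^sub>R C))\<^sup>2
        + \<theta> * (norm ((1 + \<theta>) *\<^sub>R A + 2 *\<^sub>R C))\<^sup>2)"
    using lyapunov_identity[OF pos(2), of \<theta> A E B C, unfolded D, unfolded G q \<delta> e p]
    unfolding N_defs .
  also have "\<dots> \<le> 0"
    using \<theta> s by (intro mult_nonpos_nonneg) (auto simp: mult_le_0_iff)
  finally have "N\<^sub>1 - N\<^sub>3 - (1 - \<theta>) * N\<^sub>2 + (1 - \<theta>) * (inner (d + u) G - N\<^sub>4)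
      + \<theta> * (inner (d + u') e - N\<^sub>5) + (1 - \<theta>) * inner (u' - u) D \<le> 0" .
  moreover have "(1 - \<theta>) * (\<phi> + \<psi>) \<le> (1 - \<theta>) * (\<Psi> + inner (d + u) G - N\<^sub>4)"
    using i \<theta> unfolding N_defs by (intro mult_left_mono) auto
  moreover have "\<theta> * \<phi> \<le> \<theta> * (\<phi>\<^sub>m + inner d e - N\<^sub>5)"
    using ii \<theta> unfolding N_defs by (intro mult_left_mono) auto
  moreover have "\<theta> * \<psi>' \<le> \<theta> * (\<psi>\<^sub>m + inner u' (e + D))"
    using iii \<theta> by (intro mult_left_mono) auto
  moreover have "(2 - 2 * \<theta>) * \<psi>' \<le> (2 - 2 * \<theta>) * (\<psi> + inner u' D)"
    using iv \<theta> by (intro mult_left_mono) auto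
  moreover have "(1 - \<theta>) * \<psi> \<le> (1 - \<theta>) * (\<psi>' - inner u D)"
    using v \<theta> by (intro mult_left_mono) auto
  ultimately have "\<phi> + \<psi>' - inner u' D - N\<^sub>3 - (\<phi>\<^sub>m + \<psi>\<^sub>m) + N\<^sub>1
      \<le> (1 - \<theta>) * (\<Psi> - (\<phi>\<^sub>m + \<psi>\<^sub>m) + N\<^sub>2)"
    by (simp add: inner_add_left inner_add_right inner_diff_left algebra_simps)
  thus ?thesis unfolding N_defs .
qed

text \<open>The difference of the two sides is $\|v - s p\|^2 / (2s)$.\<close>
lemma inner_le_young:
  fixes p v :: "'a::real_inner"
  assumes s: "s > 0"
  shows "inner p v - s / 2 * (norm p)\<^sup>2 \<le> (norm v)\<^sup>2 / (2 * s)"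
proof -
  have "0 \<le> (norm (v - s *\<^sub>R p))\<^sup>2 / (2 * s)" using s by simp
  also have "\<dots> = (norm v)\<^sup>2 / (2 * s) - inner p v + s / 2 * (norm p)\<^sup>2"
    using s by (simp add: power2_norm_eq_inner inner_simps inner_commute field_simps)
  finally show ?thesis by simp
qed

text \<open>The theorem in terms of function values and subgradients only: \<open>\<phi>\<close> and \<open>\<psi>\<close> are the values of
  the smooth and the nonsmooth part along the iterates, and $\theta^2/s$ is the modulus of strong
  convexity. For \<open>k = 0\<close> the index \<open>k - 1\<close> is again \<open>0\<close>, which realizes the convention
  $x_{-1} = x_0$.\<close>
lemma accelerated_rate:
  fixes x d u :: "nat \<Rightarrow> 'a::real_inner" and \<phi> \<psi> :: "nat \<Rightarrow> real"
  assumes \<theta>: "0 < \<theta>" "\<theta> \<le> 1" and s: "s > 0"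
    and coco: "\<And>k. \<phi> k \<le> \<phi> (k - 1) + inner (d k) (x k - x (k - 1)) - s / 2 * (norm (d k - d (k - 1)))\<^sup>2"
    and strong: "\<And>k. \<phi> k \<le> \<phi>\<^sub>m + inner (d k) (x k - xm) - \<theta>\<^sup>2 / (2 * s) * (norm (x k - xm))\<^sup>2"
    and descent: "\<phi>\<^sub>m \<le> \<phi> 0 - inner (d 0) (x 0 - xm) + (norm (x 0 - xm))\<^sup>2 / (2 * s)"
    and sub: "\<And>i j. \<psi> j \<le> \<psi> i + inner (u j) (x j - x i)"
    and sub_min: "\<And>k. \<psi> k \<le> \<psi>\<^sub>m + inner (u k) (x k - xm)"
    and step: "\<And>k. (1 + \<theta>) *\<^sub>R x (Suc k) + (2 * s) *\<^sub>R u (Suc k)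
      = 2 *\<^sub>R (x k - s *\<^sub>R d k) - (1 - \<theta>) *\<^sub>R (x (k - 1) - s *\<^sub>R d (k - 1)) + ((1 - \<theta>) * s) *\<^sub>R u k"
  shows "\<phi> k + \<psi> k - (\<phi>\<^sub>m + \<psi>\<^sub>m) \<le> (1 - \<theta>) ^ k *
    (\<phi> 0 + \<psi> 0 - (\<phi>\<^sub>m + \<psi>\<^sub>m) + \<theta> / (1 + \<theta>) * (inner (u 0) (x 0 - xm) - (\<psi> 0 - \<psi>\<^sub>m))
      + \<theta> / (2 * s) * (norm (x 0 - xm))\<^sup>2)"
proof -
  define G where "G k = x k - (x (k - 1) - s *\<^sub>R d (k - 1)) + s *\<^sub>R u k" for k
  define e where "e k = x k - xm" for k
  define \<Psi> where "\<Psi> k = \<phi> (k - 1) + \<psi> k - inner (u k) (x k - x (k - 1))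
    - s / 2 * (norm (d (k - 1) + u k))\<^sup>2" for k
  define \<Phi> where "\<Phi> k = \<Psi> k - (\<phi>\<^sub>m + \<psi>\<^sub>m) + (norm (G k + \<theta> *\<^sub>R e k))\<^sup>2 / (2 * s)" for k
  have gain: "\<phi> k + \<psi> k \<le> \<Psi> k + inner (d k + u k) (G k) - s / 2 * (norm (d k + u k))\<^sup>2" for k
  proof -
    have "inner (d k) (x k - x (k - 1)) - s / 2 * (norm (d k - d (k - 1)))\<^sup>2
      = - inner (u k) (x k - x (k - 1)) - s / 2 * (norm (d (k - 1) + u k))\<^sup>2
        + inner (d k + u k) (G k) - s / 2 * (norm (d k + u k))\<^sup>2"
      unfolding G_def by (simp add: power2_norm_eq_inner inner_simps inner_commute field_simps)
    with coco[of k] show ?thesis unfolding \<Psi>_def by linarith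
  qed
  have upper: "(1 + \<theta>) * (\<phi> k + \<psi> k - (\<phi>\<^sub>m + \<psi>\<^sub>m)) \<le> \<Phi> k" for k
  proof -
    let ?p = "d k + u k" and ?V = "G k + \<theta> *\<^sub>R e k"
    have "\<phi> k + \<psi> k - (\<phi>\<^sub>m + \<psi>\<^sub>m) \<le> inner ?p (e k)"
    proof -
      have "0 \<le> \<theta>\<^sup>2 / (2 * s) * (norm (x k - xm))\<^sup>2" using s by simp
      thus ?thesis using strong[of k] sub_min[of k] by (simp add: e_def inner_add_left)
    qed
    hence "\<theta> * (\<phi> k + \<psi> k - (\<phi>\<^sub>m + \<psi>\<^sub>m)) \<le> \<theta> * inner ?p (e k)"
      using \<theta> by (intro mult_left_mono) auto
    moreover have "inner ?p ?V - s / 2 * (norm ?p)\<^sup>2 \<le> (norm ?V)\<^sup>2 / (2 * s)"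
      by (rule inner_le_young[OF s])
    ultimately show ?thesis
      using gain[of k] unfolding \<Phi>_def by (simp add: inner_add_right algebra_simps)
  qed
  have decay: "\<Phi> (Suc k) \<le> (1 - \<theta>) * \<Phi> k" for k
  proof -
    let ?D = "x (Suc k) - x k"
    have rel: "(1 + \<theta>) *\<^sub>R ?D + (2 * s) *\<^sub>R (d k + u (Suc k)) = (1 - \<theta>) *\<^sub>R G k"
      using step[of k] unfolding G_def by (simp add: algebra_simps scaleR_2)
    \<comment> \<open>The mirror step: average with \<open>x k\<close>, then move along \<open>d k + u (Suc k)\<close>.\<close>
    have V: "G (Suc k) + \<theta> *\<^sub>R e (Suc k)
        = (1 - \<theta>) *\<^sub>R G k + \<theta> *\<^sub>R e k - s *\<^sub>R (d k + u (Suc k))"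
      unfolding rel[symmetric] by (simp add: G_def e_def algebra_simps flip: scaleR_2)
    have "e k + ?D = e (Suc k)" by (simp add: e_def)
    thus ?thesis
      using lyapunov_step[OF \<theta> s rel gain strong[of k, folded e_def], of "\<psi> (Suc k)" \<psi>\<^sub>m]
        sub_min[of "Suc k"] sub[of "Suc k" k] sub[of k "Suc k"]
      unfolding \<Phi>_def V by (simp add: \<Psi>_def e_def inner_diff_right)
  qed
  have geometric: "\<Phi> k \<le> (1 - \<theta>) ^ k * \<Phi> 0" for k
  proof (induction k)
    case (Suc k)
    have "\<Phi> (Suc k) \<le> (1 - \<theta>) * ((1 - \<theta>) ^ k * \<Phi> 0)"
      using decay[of k] mult_left_mono[OF Suc, of "1 - \<theta>"] \<theta> by linarith
    thus ?case by (simp add: mult.assoc)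
  qed simp
  let ?R = "\<phi> 0 + \<psi> 0 - (\<phi>\<^sub>m + \<psi>\<^sub>m) + \<theta> / (1 + \<theta>) * (inner (u 0) (x 0 - xm) - (\<psi> 0 - \<psi>\<^sub>m))
      + \<theta> / (2 * s) * (norm (x 0 - xm))\<^sup>2"
  have "\<Phi> 0 \<le> (1 + \<theta>) * ?R"
  proof -
    have expand: "(1 + \<theta>) * (a + \<theta> / (1 + \<theta>) * b + \<theta> / (2 * s) * c)
        = (1 + \<theta>) * a + \<theta> * b + (\<theta> + \<theta>\<^sup>2) / (2 * s) * c" for a b c
    proof -
      have "(1 + \<theta>) * (\<theta> / (1 + \<theta>) * b) = \<theta> * b" using \<theta> by simp
      moreover have "(1 + \<theta>) * (\<theta> / (2 * s) * c) = (\<theta> + \<theta>\<^sup>2) / (2 * s) * c"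
        by (simp add: power2_eq_square distrib_right)
      ultimately show ?thesis by (simp only: distrib_left)
    qed
    have V: "G 0 + \<theta> *\<^sub>R e 0 = \<theta> *\<^sub>R (x 0 - xm) + s *\<^sub>R (d 0 + u 0)"
      by (simp add: G_def e_def algebra_simps)
    have square: "(norm (\<theta> *\<^sub>R v + s *\<^sub>R p))\<^sup>2 / (2 * s)
        = \<theta>\<^sup>2 / (2 * s) * (norm v)\<^sup>2 + \<theta> * inner p v + s / 2 * (norm p)\<^sup>2" for v p :: 'a
      unfolding power2_norm_eq_inner using s
      by (simp add: inner_simps inner_commute power2_eq_square field_simps)
    have "\<Phi> 0 = \<phi> 0 + \<psi> 0 - (\<phi>\<^sub>m + \<psi>\<^sub>m) + \<theta> * inner (d 0 + u 0) (x 0 - xm)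
        + \<theta>\<^sup>2 / (2 * s) * (norm (x 0 - xm))\<^sup>2"
      unfolding \<Phi>_def \<Psi>_def V square by (simp add: inner_add_left add.commute)
    moreover have "\<theta> * \<phi>\<^sub>m \<le> \<theta> * (\<phi> 0 - inner (d 0) (x 0 - xm) + (norm (x 0 - xm))\<^sup>2 / (2 * s))"
      using descent \<theta> by (intro mult_left_mono) auto
    moreover have "(1 + \<theta>) * ?R = (1 + \<theta>) * (\<phi> 0 + \<psi> 0 - (\<phi>\<^sub>m + \<psi>\<^sub>m))
        + \<theta> * (inner (u 0) (x 0 - xm) - (\<psi> 0 - \<psi>\<^sub>m))
        + (\<theta> + \<theta>\<^sup>2) / (2 * s) * (norm (x 0 - xm))\<^sup>2"
      by (rule expand)
    ultimately show ?thesis by (simp add: inner_add_left add_divide_distrib algebra_simps)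
  qed
  hence "(1 - \<theta>) ^ k * \<Phi> 0 \<le> (1 - \<theta>) ^ k * ((1 + \<theta>) * ?R)"
    using \<theta> by (intro mult_left_mono) auto
  hence "(1 + \<theta>) * (\<phi> k + \<psi> k - (\<phi>\<^sub>m + \<psi>\<^sub>m)) \<le> (1 + \<theta>) * ((1 - \<theta>) ^ k * ?R)"
    using upper[of k] geometric[of k] by (simp only: mult.left_commute)
  thus ?thesis using \<theta> by (simp only: mult_le_cancel_left_pos add_pos_pos zero_less_one)
qed

section \<open>Linear convergence of the accelerated proximal gradient method\<close>

theorem theorem9:
  fixes f :: "'a::{real_inner, complete_space} \<Rightarrow> real"
    and g F :: "'a \<Rightarrow> ereal"
    and x y z :: "nat \<Rightarrow> 'a"
    and xstar :: 'a
    and Fstar \<eta>\<^sub>0 :: ereal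
    and \<mu> L s \<theta> :: real
    and lam \<gamma> :: "nat \<Rightarrow> real"
  assumes "\<mu> > 0" and "strongly_convex \<mu> f"
    and "L > 0" and "smooth L f"
    and "ereal_convex g" and "proper g" and "lower_semicontinuous g"
    and "F = (\<lambda>x. ereal (f x) + g x)"
    and "is_arg_min F (\<lambda>_. True) xstar"
    and "Fstar = (INF x. F x)"
    and "s \<in> {0<..1 / L}"
    and "\<theta> = sqrt (\<mu> * s)"
    and "\<And>k. lam (Suc k) = (1 - \<theta>) / (1 + \<theta>)"
    and "\<gamma> 0 = s"
    and "\<And>k. \<gamma> (Suc k) = (1 + lam (Suc k)) * s"
    and "x 0 = prox (\<gamma> 0) g (z 0)"
    and "y 0 = x 0 - s *\<^sub>R gradient f (x 0)"
    and "\<And>k. y (Suc k) = x k - s *\<^sub>R gradient f (x k)"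
    and "\<And>k. z (Suc k) = y (Suc k) + lam (Suc k) *\<^sub>R (y (Suc k) - y k)
                 + (lam (Suc k) * s / \<gamma> k) *\<^sub>R (z k - x k)"
    and "\<And>k. x (Suc k) = prox (\<gamma> (Suc k)) g (z (Suc k))"
    and "\<eta>\<^sub>0 = ereal (inner ((z 0 - x 0) /\<^sub>R \<gamma> 0) (x 0 - xstar)) - (g (x 0) - g xstar)"
  shows "\<forall>k. F (x k) - Fstar \<le>
    ereal ((1 - \<theta>) ^ k) *
      (F (x 0) - Fstar + ereal (\<theta> / (1 + \<theta>)) * \<eta>\<^sub>0
        + ereal (\<theta> / (2 * s) * (norm (x 0 - xstar))\<^sup>2))"
proof -
  note \<mu> = assms(1) and sc = assms(2) and L = assms(3) and sm = assms(4)
    and conv = assms(5) and propr = assms(6) and lsc = assms(7) and F = assms(8)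
    and xstar = assms(9) and \<theta> = assms(12) and lam = assms(13) and \<gamma>0 = assms(14)
    and \<gamma>Suc = assms(15) and y0 = assms(17) and ySuc = assms(18)
    and zSuc = assms(19) and \<eta>\<^sub>0 = assms(21)
  have s: "0 < s" and sL: "s \<le> 1 / L" using assms(11) by auto
  have f': "GDERIV f w :> gradient f w" for w
    using sm GDERIV_gradient by (auto simp: smooth_def)
  have lip: "L-lipschitz_on UNIV (gradient f)" using sm by (simp add: smooth_def)
  have "L \<le> 1 / s" using s sL L by (simp add: field_simps)
  hence lip_s: "(1 / s)-lipschitz_on UNIV (gradient f)" by (rule lipschitz_on_le[OF lip])
  have \<theta>_pos: "0 < \<theta>" and \<theta>2: "\<theta>\<^sup>2 = \<mu> * s" using \<mu> s by (simp_all add: \<theta>)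

  have min: "F xstar \<le> F w" for w using xstar by (simp add: is_arg_min_linorder)
  have Fstar: "Fstar = F xstar"
    unfolding assms(10) by (rule antisym[OF INF_lower INF_greatest]) (auto intro: min)
  obtain v where "g v \<noteq> \<infinity>" using propr by (auto simp: proper_def)
  hence "g xstar \<noteq> \<infinity>" using min[of v] by (auto simp: F)
  then obtain \<psi>\<^sub>m where \<psi>\<^sub>m: "g xstar = ereal \<psi>\<^sub>m"
    using propr unfolding proper_def by (metis ereal_cases)

  \<comment> \<open>Since \<open>xstar\<close> minimizes \<open>F\<close>, the negative gradient there is a subgradient of \<open>g\<close>, and
    the resulting affine minorant supplies the growth bound for the proximal points.\<close>
  define D where "D = gradient f xstar"
  have growth: "ereal (\<psi>\<^sub>m + inner D xstar - norm D * norm w) \<le> g w" for w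
  proof -
    have "ereal (\<psi>\<^sub>m + inner D xstar - norm D * norm w) \<le> g xstar + ereal (inner (- D) (w - xstar))"
      using norm_cauchy_schwarz[of D w] by (simp add: \<psi>\<^sub>m inner_diff_right)
    also have "\<dots> \<le> g w"
      unfolding D_def using min by (intro subgradient_at_minimizer[OF f' conv \<psi>\<^sub>m]) (simp add: F)
    finally show ?thesis .
  qed
  have \<gamma>: "\<gamma> k > 0" for k
  proof (cases k)
    case (Suc j)
    have "1 + lam (Suc j) = 2 / (1 + \<theta>)" using \<theta>_pos by (simp add: lam field_simps)
    thus ?thesis using Suc \<gamma>Suc s \<theta>_pos by simp
  qed (simp add: \<gamma>0 s)
  have x: "x k = prox (\<gamma> k) g (z k)" for k
    by (cases k) (simp_all add: assms(16,20))
  define u where "u k = (z k - x k) /\<^sub>R \<gamma> k" for k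
  define \<psi> where "\<psi> k = real_of_ereal (g (x k))" for k
  note prox = prox_subgradient[OF \<gamma> conv propr lsc growth]
  have \<psi>: "g (x k) = ereal (\<psi> k)" for k
  proof -
    have "g (x k) \<noteq> \<infinity>" "g (x k) \<noteq> - \<infinity>"
      using prox(1)[of k "z k"] propr by (auto simp: x[of k] proper_def)
    thus ?thesis unfolding \<psi>_def by (cases "g (x k)") auto
  qed
  have sub: "g (x k) + ereal (inner (u k) (w - x k)) \<le> g w" for k w
    using prox(2)[of k "z k" w] by (simp add: x[symmetric] u_def)

  have F_diff: "F (x k) - Fstar = ereal (f (x k) + \<psi> k - (f xstar + \<psi>\<^sub>m))" for k
    by (simp add: Fstar F \<psi> \<psi>\<^sub>m)
  have \<eta>: "\<eta>\<^sub>0 = ereal (inner (u 0) (x 0 - xstar) - (\<psi> 0 - \<psi>\<^sub>m))"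
    by (simp add: \<eta>\<^sub>0 \<psi> \<psi>\<^sub>m u_def)

  have "f (x k) + \<psi> k - (f xstar + \<psi>\<^sub>m) \<le> (1 - \<theta>) ^ k *
      (f (x 0) + \<psi> 0 - (f xstar + \<psi>\<^sub>m) + \<theta> / (1 + \<theta>) * (inner (u 0) (x 0 - xstar) - (\<psi> 0 - \<psi>\<^sub>m))
        + \<theta> / (2 * s) * (norm (x 0 - xstar))\<^sup>2)" for k
  proof (cases "\<exists>p q :: 'a. p \<noteq> q")
    case False
    \<comment> \<open>In the trivial space \<open>\<mu> \<le> L\<close> may fail, but every gap is zero.\<close>
    hence "x j = xstar" for j by blast
    moreover from this have "\<psi> j = \<psi>\<^sub>m" for j using \<psi>[of j] \<psi>\<^sub>m by simp
    ultimately show ?thesis by simp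
  next
    case True
    then obtain p q :: 'a where "p \<noteq> q" by blast
    have "\<mu> \<le> L" by (rule strong_convexity_le_smoothness[OF f' sc lip \<open>p \<noteq> q\<close>])
    hence "\<mu> * s \<le> L * s" using s by simp
    also have "\<dots> \<le> 1" using sL L by (simp add: field_simps)
    finally have \<theta>_le: "\<theta> \<le> 1" by (simp add: \<theta>)
    have y: "y k = x (k - 1) - s *\<^sub>R gradient f (x (k - 1))" for k
      by (cases k) (simp_all add: y0 ySuc)
    have grad_ineq: "f a + inner (gradient f a) (w - a) + \<mu> / 2 * (norm (w - a))\<^sup>2 \<le> f w" for a w
      by (rule strongly_convex_gradient_inequality[OF sc f'])
    have "0 \<le> \<mu> / 2 * (norm (w - a))\<^sup>2" for a w :: 'a using \<mu> by simp
    hence "f a + inner (gradient f a) (w - a) \<le> f w" for a w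
      using grad_ineq[of a w] by (smt (verit))
    note coco = cocoercivity[OF f' this s lip_s]
    have flip: "inner a (b - c) = - inner a (c - b)" for a b c :: 'a
      by (simp add: inner_diff_right)
    show ?thesis
    proof (rule accelerated_rate[where d = "\<lambda>k. gradient f (x k)" and u = u
          and \<phi> = "\<lambda>k. f (x k)", OF \<theta>_pos \<theta>_le s])
      fix k
      show "f (x k) \<le> f (x (k - 1)) + inner (gradient f (x k)) (x k - x (k - 1))
          - s / 2 * (norm (gradient f (x k) - gradient f (x (k - 1))))\<^sup>2"
        using coco[of "x k" "x (k - 1)"] flip[of "gradient f (x k)" "x k" "x (k - 1)"]
        by (simp add: norm_minus_commute)
      show "f (x k) \<le> f xstar + inner (gradient f (x k)) (x k - xstar)
          - \<theta>\<^sup>2 / (2 * s) * (norm (x k - xstar))\<^sup>2"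
        using grad_ineq[of "x k" xstar] flip[of "gradient f (x k)" "x k" xstar] s
        by (simp add: \<theta>2 norm_minus_commute)
      show "\<psi> k \<le> \<psi>\<^sub>m + inner (u k) (x k - xstar)"
        using sub[of k xstar] flip[of "u k" "x k" xstar] by (simp add: \<psi> \<psi>\<^sub>m)
      show "(1 + \<theta>) *\<^sub>R x (Suc k) + (2 * s) *\<^sub>R u (Suc k)
          = 2 *\<^sub>R (x k - s *\<^sub>R gradient f (x k))
            - (1 - \<theta>) *\<^sub>R (x (k - 1) - s *\<^sub>R gradient f (x (k - 1))) + ((1 - \<theta>) * s) *\<^sub>R u k"
      proof -
        have zu: "z j = x j + \<gamma> j *\<^sub>R u j" for j using \<gamma>[of j] by (simp add: u_def)
        have pos: "1 + \<theta> \<noteq> 0" using \<theta>_pos by simp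
        have l: "(1 + \<theta>) * lam (Suc k) = 1 - \<theta>" using pos by (simp add: lam)
        have "(1 + \<theta>) * \<gamma> (Suc k) = ((1 + \<theta>) + (1 + \<theta>) * lam (Suc k)) * s"
          by (simp only: \<gamma>Suc) (simp add: algebra_simps)
        hence g2: "(1 + \<theta>) * \<gamma> (Suc k) = 2 * s" unfolding l by simp
        have "x (Suc k) + \<gamma> (Suc k) *\<^sub>R u (Suc k)
            = y (Suc k) + lam (Suc k) *\<^sub>R (y (Suc k) - y k) + (lam (Suc k) * s) *\<^sub>R u k"
          using zSuc[of k] \<gamma>[of k] unfolding zu[of "Suc k"] zu[of k] by simp
        hence "(1 + \<theta>) *\<^sub>R (x (Suc k) + \<gamma> (Suc k) *\<^sub>R u (Suc k)) = (1 + \<theta>) *\<^sub>R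
            (y (Suc k) + lam (Suc k) *\<^sub>R (y (Suc k) - y k) + (lam (Suc k) * s) *\<^sub>R u k)"
          by simp
        hence "(1 + \<theta>) *\<^sub>R x (Suc k) + (2 * s) *\<^sub>R u (Suc k)
            = (1 + \<theta>) *\<^sub>R y (Suc k) + (1 - \<theta>) *\<^sub>R (y (Suc k) - y k) + ((1 - \<theta>) * s) *\<^sub>R u k"
          by (simp only: scaleR_add_right scaleR_scaleR mult.assoc[symmetric] l g2)
        also have "\<dots> = 2 *\<^sub>R y (Suc k) - (1 - \<theta>) *\<^sub>R y k + ((1 - \<theta>) * s) *\<^sub>R u k"
          by (simp add: algebra_simps flip: scaleR_2)
        finally show ?thesis by (simp add: y)
      qed
    next
      show "f xstar \<le> f (x 0) - inner (gradient f (x 0)) (x 0 - xstar) + (norm (x 0 - xstar))\<^sup>2 / (2 * s)"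
        using descent_lemma[OF f' lip_s, of xstar "x 0"] flip[of "gradient f (x 0)" "x 0" xstar]
        by (simp add: norm_minus_commute)
    next
      fix i j
      show "\<psi> j \<le> \<psi> i + inner (u j) (x j - x i)"
        using sub[of j "x i"] flip[of "u j" "x j" "x i"] by (simp add: \<psi>)
    qed
  qed
  thus ?thesis by (simp add: F_diff \<eta>)
qed

end
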